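(* Fix $q>0$ and let $I=[-1,1]$. For $\varepsilon>0$ and $F\in C^1(I)$ with $F(-1)=0$, define, for $I$-valued fields $u=u(\boldsymbol x,t)$, $$\mathcal N(u;\varepsilon,F)=u_t-q\left(\Delta u-\frac{F'(u)}{\varepsilon^2}\right).$$ (i) For every $\varepsilon>0$, every $F\in C^1(I)$ with $F(-1)=0$, every $s>0$ and every sufficiently regular $I$-valued field $u$, $\mathcal N(u;s\varepsilon,s^2F)=\mathcal N(u;\varepsilon,F)$. (ii) Two pairs $(\varepsilon_1,F_1)$ and $(\varepsilon_2,F_2)$ with $\varepsilon_i>0$, $F_i\in C^1(I)$, $F_i(-1)=0$ have the same effective force on all of $I$, i.e. $F_1'(u)/\varepsilon_1^2=F_2'(u)/\varepsilon_2^2$ for all $u\in I$, if and only if they belong to the same equivalence class $[(\varepsilon,F)]=\{(s\varepsilon,s^2F):s>0\}$, i.e. there exists $s>0$ with $(\varepsilon_2,F_2)=(s\varepsilon_1,s^2F_1)$. (iii) Consequently, observations governed by this operator cannot distinguish members of a class under the same initial and boundary data: if $(\varepsilon_1,F_1)$ and $(\varepsilon_2,F_2)$ belong to the same class, then a sufficiently regular $I$-valued field $u$ with given initial and boundary data satisfies $\mathcal N(u;\varepsilon_1,F_1)=0$ if and only if it satisfies $\mathcal N(u;\varepsilon_2,F_2)=0$.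
   Context: Fields $u(\boldsymbol x,t)$ are functions of a spatial variable $\boldsymbol x\in\Omega\subset\mathbb R^2$ and time $t$; "sufficiently regular" means that $u_t$ and $\Delta u$ are defined (for example $C^2$ in space and $C^1$ in time). The effective force of a pair $(\varepsilon,F)$ is $G(u)=F'(u)/\varepsilon^2$ on $I$. A pair is called normalized when $F(-1)=0$. The Allen--Cahn equation is $\mathcal N(u;\varepsilon,F)=0$. *)

theory Defs
  imports "HOL-Analysis.Analysis" "HOL-Library.FuncSet"
begin

abbreviation phase_interval :: "real set"
  where "phase_interval \<equiv> {-1..1}"

(* The derivative of F relative to the phase interval (one-sided at -1 and 1),
   so that only the values of F on the interval matter. *)
definition potential_deriv :: "(real \<Rightarrow> real) \<Rightarrow> real \<Rightarrow> real"
  where "potential_deriv F v = vector_derivative F (at v within phase_interval)"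

(* C^1(I). Functions on I are represented extensionally, so that HOL equality of two
   members is equality on I. *)
definition C1_potentials :: "(real \<Rightarrow> real) set"
  where "C1_potentials =
    {F \<in> extensional phase_interval.
       F differentiable_on phase_interval \<and> continuous_on phase_interval (potential_deriv F)}"

definition normalized_pair :: "real \<Rightarrow> (real \<Rightarrow> real) \<Rightarrow> bool"
  where "normalized_pair \<epsilon> F \<longleftrightarrow> \<epsilon> > 0 \<and> F \<in> C1_potentials \<and> F (-1) = 0"

definition effective_force :: "real \<Rightarrow> (real \<Rightarrow> real) \<Rightarrow> real \<Rightarrow> real"
  where "effective_force \<epsilon> F v = potential_deriv F v / \<epsilon>\<^sup>2"

definition scale_potential :: "real \<Rightarrow> (real \<Rightarrow> real) \<Rightarrow> real \<Rightarrow> real"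
  where "scale_potential s F = (\<lambda>v\<in>phase_interval. s\<^sup>2 * F v)"

definition pair_class :: "real \<Rightarrow> (real \<Rightarrow> real) \<Rightarrow> (real \<times> (real \<Rightarrow> real)) set"
  where "pair_class \<epsilon> F = {(s * \<epsilon>, scale_potential s F) | s. s > 0}"

definition same_class :: "real \<times> (real \<Rightarrow> real) \<Rightarrow> real \<times> (real \<Rightarrow> real) \<Rightarrow> bool"
  where "same_class p1 p2 \<longleftrightarrow>
    (\<exists>\<epsilon> F. normalized_pair \<epsilon> F \<and> p1 \<in> pair_class \<epsilon> F \<and> p2 \<in> pair_class \<epsilon> F)"

definition partial_deriv :: "'a::euclidean_space \<Rightarrow> ('a \<Rightarrow> real) \<Rightarrow> 'a \<Rightarrow> real"
  where "partial_deriv b f x = deriv (\<lambda>h. f (x + h *\<^sub>R b)) 0"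

definition laplacian :: "('a::euclidean_space \<Rightarrow> real) \<Rightarrow> 'a \<Rightarrow> real"
  where "laplacian f x = (\<Sum>b\<in>Basis. partial_deriv b (partial_deriv b f) x)"

type_synonym field = "real ^ 2 \<Rightarrow> real \<Rightarrow> real"

(* Relative to the time interval J, hence one-sided at an end point belonging to J. *)
definition time_deriv :: "real set \<Rightarrow> field \<Rightarrow> field"
  where "time_deriv J u x t = vector_derivative (\<lambda>\<tau>. u x \<tau>) (at t within J)"

(* The derivatives entering u_t and the Laplacian exist throughout \<Omega> \<times> J; their
   continuity is not required, so C^2 in space and C^1 in time is a special case. *)
definition regular_field :: "(real ^ 2) set \<Rightarrow> real set \<Rightarrow> field \<Rightarrow> bool"
  where "regular_field \<Omega> J u \<longleftrightarrow>
    (\<forall>x\<in>\<Omega>. \<forall>t\<in>J.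
       (\<lambda>\<tau>. u x \<tau>) differentiable (at t within J) \<and>
       (\<forall>b\<in>Basis.
          (\<lambda>h. u (x + h *\<^sub>R b) t) differentiable (at 0) \<and>
          (\<lambda>h. partial_deriv b (\<lambda>y. u y t) (x + h *\<^sub>R b)) differentiable (at 0)))"

definition phase_valued :: "(real ^ 2) set \<Rightarrow> real set \<Rightarrow> field \<Rightarrow> bool"
  where "phase_valued \<Omega> J u \<longleftrightarrow> (\<forall>x\<in>\<Omega>. \<forall>t\<in>J. u x t \<in> phase_interval)"

definition allen_cahn_op :: "real \<Rightarrow> real set \<Rightarrow> real \<Rightarrow> (real \<Rightarrow> real) \<Rightarrow> field \<Rightarrow> field"
  where "allen_cahn_op q J \<epsilon> F u x t =
    time_deriv J u x t - q * (laplacian (\<lambda>y. u y t) x - potential_deriv F (u x t) / \<epsilon>\<^sup>2)"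

definition allen_cahn_eq ::
    "real \<Rightarrow> (real ^ 2) set \<Rightarrow> real set \<Rightarrow> real \<Rightarrow> (real \<Rightarrow> real) \<Rightarrow> field \<Rightarrow> bool"
  where "allen_cahn_eq q \<Omega> J \<epsilon> F u \<longleftrightarrow> (\<forall>x\<in>\<Omega>. \<forall>t\<in>J. allen_cahn_op q J \<epsilon> F u x t = 0)"

(* J may or may not contain the initial time 0, and may be bounded or not. *)
definition time_interval :: "real set \<Rightarrow> bool"
  where "time_interval J \<longleftrightarrow>
    is_interval J \<and> interior J \<noteq> {} \<and> J \<subseteq> {0..} \<and> 0 \<in> closure J"

definition has_initial_data :: "(real ^ 2) set \<Rightarrow> (real ^ 2 \<Rightarrow> real) \<Rightarrow> field \<Rightarrow> bool"
  where "has_initial_data \<Omega> u0 u \<longleftrightarrow> (\<forall>x\<in>\<Omega>. u x 0 = u0 x)"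

(* B is an arbitrary boundary operator and g the prescribed data: B u = u gives Dirichlet
   data, B u = normal derivative of u gives Neumann data; other value types allow, for
   instance, the pairs of conditions needed for periodicity. *)
definition has_boundary_data ::
    "(real ^ 2) set \<Rightarrow> real set \<Rightarrow> (field \<Rightarrow> real ^ 2 \<Rightarrow> real \<Rightarrow> 'b) \<Rightarrow>
     (real ^ 2 \<Rightarrow> real \<Rightarrow> 'b) \<Rightarrow> field \<Rightarrow> bool"
  where "has_boundary_data \<Omega> J B g u \<longleftrightarrow> (\<forall>x\<in>frontier \<Omega>. \<forall>t\<in>J. B u x t = g x t)"

end

theory Submission
  imports Defs
begin

text \<open>The derivative is linear, so replacing \<open>(\<epsilon>, F)\<close> by \<open>(s * \<epsilon>, s\<^sup>2 * F)\<close> multiplies both the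
  numerator and the denominator of the effective force \<open>F' / \<epsilon>\<^sup>2\<close> by \<open>s\<^sup>2\<close>
  (\<open>effective_force_rescaled\<close>). Since the Allen--Cahn operator sees \<open>\<epsilon>\<close> and \<open>F\<close> only through this
  quotient, it is unchanged. This settles the invariance of the operator and of its solution set.

  Conversely, equal effective forces mean \<open>F2' = (\<epsilon>2 / \<epsilon>1)\<^sup>2 * F1'\<close> on the phase interval. With
  \<open>s = \<epsilon>2 / \<epsilon>1\<close>, the potentials \<open>F2\<close> and \<open>s\<^sup>2 * F1\<close> then have the same derivative on an interval, so
  they differ by a constant, and the normalization at \<open>-1\<close> makes this constant zero
  (\<open>potential_eqI\<close>). Finally, rescalings form a group under composition, so belonging to a common
  class is the same as being obtained from each other by one rescaling.\<close>

lemma potential_has_vector_derivative: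
  assumes "F \<in> C1_potentials" and "v \<in> phase_interval"
  shows "(F has_vector_derivative potential_deriv F v) (at v within phase_interval)"
  using assms unfolding C1_potentials_def potential_deriv_def differentiable_on_def
  by (auto simp flip: vector_derivative_works)

lemma potential_deriv_eqI:
  assumes "(F has_vector_derivative d) (at v within phase_interval)" and "v \<in> phase_interval"
  shows "potential_deriv F v = d"
  unfolding potential_deriv_def
  using vector_derivative_within_cbox[of "-1" 1 v F d] assms by simp

lemma scale_potential_has_vector_derivative:
  assumes "F \<in> C1_potentials" and "v \<in> phase_interval"
  shows "(scale_potential s F has_vector_derivative s\<^sup>2 * potential_deriv F v)
           (at v within phase_interval)"
proof (rule has_vector_derivative_transform)
  show "((\<lambda>w. s\<^sup>2 * F w) has_vector_derivative s\<^sup>2 * potential_deriv F v)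
          (at v within phase_interval)"
    using assms by (intro has_vector_derivative_mult_right potential_has_vector_derivative)
qed (use assms in \<open>simp_all add: scale_potential_def\<close>)

lemma effective_force_rescaled:
  assumes "F \<in> C1_potentials" and "v \<in> phase_interval" and "s \<noteq> 0"
  shows "effective_force (s * \<epsilon>) (scale_potential s F) v = effective_force \<epsilon> F v"
  using assms(3) potential_deriv_eqI[OF scale_potential_has_vector_derivative[OF assms(1,2)] assms(2)]
  by (simp add: effective_force_def power_mult_distrib)

lemma allen_cahn_op_cong_force:
  assumes "effective_force \<epsilon>1 F1 (u x t) = effective_force \<epsilon>2 F2 (u x t)"
  shows "allen_cahn_op q J \<epsilon>1 F1 u x t = allen_cahn_op q J \<epsilon>2 F2 u x t"
  using assms by (simp add: allen_cahn_op_def effective_force_def)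

text \<open>Agreement at \<open>-1\<close> fixes the constant of integration, and extensionality turns
  equality on the phase interval into equality of functions.\<close>

lemma potential_eqI:
  assumes "\<And>v. v \<in> phase_interval \<Longrightarrow> (F has_vector_derivative d v) (at v within phase_interval)"
    and "\<And>v. v \<in> phase_interval \<Longrightarrow> (G has_vector_derivative d v) (at v within phase_interval)"
    and "F (-1) = G (-1)"
    and "F \<in> extensional phase_interval" and "G \<in> extensional phase_interval"
  shows "F = G"
proof (rule extensionalityI[OF assms(4,5)])
  have "((\<lambda>v. F v - G v) has_vector_derivative 0) (at v within phase_interval)"
    if "v \<in> phase_interval" for v
    using has_vector_derivative_diff[OF assms(1,2)[OF that]] by simp
  then obtain c where c: "\<And>v. v \<in> phase_interval \<Longrightarrow> F v - G v = c"
    using has_vector_derivative_zero_constant[of phase_interval "\<lambda>v. F v - G v"]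
    by (metis convex_real_interval(5))
  have "c = 0"
    using c[of "-1"] assms(3) by simp
  then show "F v = G v" if "v \<in> phase_interval" for v
    using c[OF that] by simp
qed

lemma scale_potential_scale_potential:
  "scale_potential s (scale_potential r F) = scale_potential (s * r) F"
  by (auto simp: scale_potential_def fun_eq_iff power_mult_distrib)

lemma scale_potential_one:
  "F \<in> extensional phase_interval \<Longrightarrow> scale_potential 1 F = F"
  by (simp add: scale_potential_def extensional_restrict)

text \<open>Two members of the class of \<open>(\<epsilon>, F)\<close> with factors \<open>r\<close> and \<open>s\<close> are related by the factor
  \<open>s / r\<close>. In the other direction, the first pair itself represents a class containing both.\<close>

lemma same_class_iff_rescaled:
  assumes "normalized_pair \<epsilon>1 F1"
  shows "same_class (\<epsilon>1, F1) (\<epsilon>2, F2) \<longleftrightarrow>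
           (\<exists>s>0. (\<epsilon>2, F2) = (s * \<epsilon>1, scale_potential s F1))"
proof
  assume "same_class (\<epsilon>1, F1) (\<epsilon>2, F2)"
  then obtain \<epsilon> F r s where "r > 0" "s > 0"
    and "\<epsilon>1 = r * \<epsilon>" "F1 = scale_potential r F" "\<epsilon>2 = s * \<epsilon>" "F2 = scale_potential s F"
    by (auto simp: same_class_def pair_class_def)
  then have "s / r > 0 \<and> (\<epsilon>2, F2) = ((s / r) * \<epsilon>1, scale_potential (s / r) F1)"
    by (simp add: scale_potential_scale_potential)
  then show "\<exists>s>0. (\<epsilon>2, F2) = (s * \<epsilon>1, scale_potential s F1)"
    by blast
next
  assume "\<exists>s>0. (\<epsilon>2, F2) = (s * \<epsilon>1, scale_potential s F1)"
  then have "(\<epsilon>2, F2) \<in> pair_class \<epsilon>1 F1"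
    by (auto simp: pair_class_def)
  moreover have "(1 * \<epsilon>1, scale_potential 1 F1) \<in> pair_class \<epsilon>1 F1"
    unfolding pair_class_def using zero_less_one by blast
  then have "(\<epsilon>1, F1) \<in> pair_class \<epsilon>1 F1"
    using assms by (simp add: scale_potential_one normalized_pair_def C1_potentials_def)
  ultimately show "same_class (\<epsilon>1, F1) (\<epsilon>2, F2)"
    using assms by (auto simp: same_class_def)
qed

lemma effective_force_eq_iff_rescaled:
  assumes "normalized_pair \<epsilon>1 F1" and "normalized_pair \<epsilon>2 F2"
  shows "(\<forall>v\<in>phase_interval. effective_force \<epsilon>1 F1 v = effective_force \<epsilon>2 F2 v) \<longleftrightarrow>
           (\<exists>s>0. (\<epsilon>2, F2) = (s * \<epsilon>1, scale_potential s F1))"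
proof
  assume force: "\<forall>v\<in>phase_interval. effective_force \<epsilon>1 F1 v = effective_force \<epsilon>2 F2 v"
  have pos: "\<epsilon>1 > 0" "\<epsilon>2 > 0" and C1: "F1 \<in> C1_potentials" "F2 \<in> C1_potentials"
    and norm: "F1 (-1) = 0" "F2 (-1) = 0"
    using assms by (auto simp: normalized_pair_def)
  (* The first components of the pairs leave no other choice of the factor. *)
  define s where "s = \<epsilon>2 / \<epsilon>1"
  have deriv: "potential_deriv F2 v = s\<^sup>2 * potential_deriv F1 v" if "v \<in> phase_interval" for v
    using force that pos by (simp add: effective_force_def s_def field_simps)
  have "F2 = scale_potential s F1"
  proof (rule potential_eqI)
    show "(F2 has_vector_derivative potential_deriv F2 v) (at v within phase_interval)"
      if "v \<in> phase_interval" for v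
      using that by (rule potential_has_vector_derivative[OF C1(2)])
    show "(scale_potential s F1 has_vector_derivative potential_deriv F2 v)
            (at v within phase_interval)" if "v \<in> phase_interval" for v
      using scale_potential_has_vector_derivative[OF C1(1) that] deriv[OF that] by simp
  qed (use C1(2) norm in \<open>simp_all add: scale_potential_def C1_potentials_def\<close>)
  then show "\<exists>s>0. (\<epsilon>2, F2) = (s * \<epsilon>1, scale_potential s F1)"
    using pos by (intro exI[of _ s]) (simp add: s_def)
next
  assume "\<exists>s>0. (\<epsilon>2, F2) = (s * \<epsilon>1, scale_potential s F1)"
  then show "\<forall>v\<in>phase_interval. effective_force \<epsilon>1 F1 v = effective_force \<epsilon>2 F2 v"
    using assms(1) by (auto simp: effective_force_rescaled normalized_pair_def)
qed

theorem proposition1: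
  fixes q :: real and \<Omega> :: "(real ^ 2) set" and J :: "real set"
  assumes "q > 0" and "open \<Omega>" and "time_interval J"
  shows
   "(\<forall>\<epsilon> F s u.
       normalized_pair \<epsilon> F \<longrightarrow> s > 0 \<longrightarrow> regular_field \<Omega> J u \<longrightarrow> phase_valued \<Omega> J u \<longrightarrow>
       (\<forall>x\<in>\<Omega>. \<forall>t\<in>J.
          allen_cahn_op q J (s * \<epsilon>) (scale_potential s F) u x t = allen_cahn_op q J \<epsilon> F u x t)) \<and>
    (\<forall>\<epsilon>1 F1 \<epsilon>2 F2.
       normalized_pair \<epsilon>1 F1 \<longrightarrow> normalized_pair \<epsilon>2 F2 \<longrightarrow>
       ((\<forall>v\<in>phase_interval. effective_force \<epsilon>1 F1 v = effective_force \<epsilon>2 F2 v) \<longleftrightarrow>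
          same_class (\<epsilon>1, F1) (\<epsilon>2, F2)) \<and>
       (same_class (\<epsilon>1, F1) (\<epsilon>2, F2) \<longleftrightarrow>
          (\<exists>s>0. (\<epsilon>2, F2) = (s * \<epsilon>1, scale_potential s F1)))) \<and>
    (\<forall>\<epsilon>1 F1 \<epsilon>2 F2 u0 (B :: field \<Rightarrow> real ^ 2 \<Rightarrow> real \<Rightarrow> 'b) g u.
       normalized_pair \<epsilon>1 F1 \<longrightarrow> normalized_pair \<epsilon>2 F2 \<longrightarrow>
       same_class (\<epsilon>1, F1) (\<epsilon>2, F2) \<longrightarrow>
       regular_field \<Omega> J u \<longrightarrow> phase_valued \<Omega> J u \<longrightarrow>
       has_initial_data \<Omega> u0 u \<longrightarrow> has_boundary_data \<Omega> J B g u \<longrightarrow>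
       (allen_cahn_eq q \<Omega> J \<epsilon>1 F1 u \<longleftrightarrow> allen_cahn_eq q \<Omega> J \<epsilon>2 F2 u))"
proof (intro conjI allI impI ballI)
  fix \<epsilon> s :: real and F u x t
  assume "normalized_pair \<epsilon> F" "s > 0" "phase_valued \<Omega> J u" "x \<in> \<Omega>" "t \<in> J"
  then show "allen_cahn_op q J (s * \<epsilon>) (scale_potential s F) u x t = allen_cahn_op q J \<epsilon> F u x t"
    by (intro allen_cahn_op_cong_force effective_force_rescaled)
      (auto simp: normalized_pair_def phase_valued_def)
next
  fix \<epsilon>1 F1 \<epsilon>2 F2
  assume pairs: "normalized_pair \<epsilon>1 F1" "normalized_pair \<epsilon>2 F2"
  show "same_class (\<epsilon>1, F1) (\<epsilon>2, F2) \<longleftrightarrow>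
          (\<exists>s>0. (\<epsilon>2, F2) = (s * \<epsilon>1, scale_potential s F1))"
    using pairs(1) by (rule same_class_iff_rescaled)
  then show "(\<forall>v\<in>phase_interval. effective_force \<epsilon>1 F1 v = effective_force \<epsilon>2 F2 v) \<longleftrightarrow>
          same_class (\<epsilon>1, F1) (\<epsilon>2, F2)"
    using effective_force_eq_iff_rescaled[OF pairs] by simp
next
  fix \<epsilon>1 F1 \<epsilon>2 F2 u
  assume pairs: "normalized_pair \<epsilon>1 F1" "normalized_pair \<epsilon>2 F2"
    and "same_class (\<epsilon>1, F1) (\<epsilon>2, F2)" and range: "phase_valued \<Omega> J u"
  then have force: "\<forall>v\<in>phase_interval. effective_force \<epsilon>1 F1 v = effective_force \<epsilon>2 F2 v"
    using effective_force_eq_iff_rescaled same_class_iff_rescaled by blast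
  have "allen_cahn_op q J \<epsilon>1 F1 u x t = allen_cahn_op q J \<epsilon>2 F2 u x t"
    if "x \<in> \<Omega>" "t \<in> J" for x t
    using force range that by (intro allen_cahn_op_cong_force) (simp add: phase_valued_def)
  then show "allen_cahn_eq q \<Omega> J \<epsilon>1 F1 u \<longleftrightarrow> allen_cahn_eq q \<Omega> J \<epsilon>2 F2 u"
    by (simp add: allen_cahn_eq_def)
qed

end
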